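(* Consider a distributed random convex program over a strongly connected directed graph $\mathcal{G}$ with local constraint sets $C_1,\dots,C_n$, such that for every $x\in X$ the function $\delta\mapsto f(x,\delta)$ is convex on $\Delta$, and let all nodes run the vertex constraints consensus (VCC) algorithm, as described in the context. Then: (i) for each node $i$, the local optimal objective $J_i^*(t)=J^*(V_i(t))$ is monotonically non-decreasing in the iterations $t$; (ii) in $T\le\mathrm{diam}(\mathcal{G})$ iterations the local solution at each node $i$ coincides with the scenario solution of the RCP, i.e. $x^*(V_i(T))=x^*(C)$; (iii) for each node $i$, the local candidate set $V_i(T)$ satisfies $V_i(T)=\mathrm{vert}(C)\supseteq\mathrm{Sc}(C)$.
   Context: Problem. Let $X\subset\mathbb{R}^d$ be compact and convex, $a\in\mathbb{R}^d$, $\Delta\subseteq\mathbb{R}^\ell$ convex, and $f:\mathbb{R}^d\times\Delta\to\mathbb{R}$ with $f(\cdot,\delta)$ convex for every $\delta\in\Delta$. Let $\delta^{(1)},\dots,\delta^{(N)}\in\Delta$ be a given realization of $N$ i.i.d. samples of a random parameter, and $C=\{1,\dots,N\}$. For $S\subseteq C$, $P[S]$ is the problem: minimize $a^\top x$ over $x\in X$ subject to $f(x,\delta^{(j)})\le 0$ for all $j\in S$; its optimal solution and value are $x^*(S)$ and $J^*(S)$, with $x^*(S)=\mathrm{NaN}$ and $J^*(S)=\infty$ if $P[S]$ is infeasible. $P[C]$ is an instance of a random convex program (RCP), and $x^*(C)$ is the scenario solution. Standing assumption (unique minimum condition): every feasible $P[S]$, $S\subseteq C$, has a unique optimal solution.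 Support constraint set: $\mathrm{Sc}(C)=\{c\in C: J^*(C\setminus\{c\})<J^*(C)\}$. Vertex set: for $S\subseteq C$, $\mathrm{vert}(S)\subseteq S$ is the set of indices $j\in S$ such that $\delta^{(j)}$ is a vertex (extreme point) of the convex hull of $\{\delta^{(k)}:k\in S\}$. Network. $\mathcal{G}$ is a strongly connected directed graph on nodes $\{1,\dots,n\}$; an edge $(i,j)$ means $i$ can transmit to $j$; $\mathcal{N}_{\rm in}(i)$ is the set of in-neighbors of $i$; $\mathrm{diam}(\mathcal{G})$ is the maximum over ordered pairs of nodes of the length of a shortest directed path. Node $i$ initially knows a subset $C_i\subset C$, with $\bigcup_{i=1}^nC_i=C$. VCC algorithm (synchronous, run by each node $i$). Initialize $V_i(0)=\mathrm{vert}(C_i)$. For $t=0,1,\dots,\mathrm{diam}(\mathcal{G})-1$: receive $V_j(t)$ from all $j\in\mathcal{N}_{\rm in}(i)$, set $L_i(t+1)=V_i(t)\cup\big(\bigcup_{j\in\mathcal{N}_{\rm in}(i)}V_j(t)\big)$ and $V_i(t+1)=\mathrm{vert}(L_i(t+1))$. The local solution and local optimal objective at iteration $t$ are $x^*(V_i(t))$ and $J^*(V_i(t))$. *)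

theory Defs
  imports "HOL-Analysis.Analysis" "Graph_Theory.Graph_Theory"
begin

definition rcp_feasible ::
  "'x set \<Rightarrow> ('x \<Rightarrow> 'p \<Rightarrow> real) \<Rightarrow> (nat \<Rightarrow> 'p) \<Rightarrow> nat set \<Rightarrow> 'x set" where
  "rcp_feasible X f \<delta> S = {x \<in> X. \<forall>j\<in>S. f x (\<delta> j) \<le> 0}"

definition rcp_optimal ::
  "('x::real_inner) set \<Rightarrow> 'x \<Rightarrow> ('x \<Rightarrow> 'p \<Rightarrow> real) \<Rightarrow> (nat \<Rightarrow> 'p) \<Rightarrow> nat set \<Rightarrow> 'x \<Rightarrow> bool" where
  "rcp_optimal X a f \<delta> S x \<longleftrightarrow> is_arg_min (\<lambda>y. a \<bullet> y) (\<lambda>y. y \<in> rcp_feasible X f \<delta> S) x"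

(* None plays the role of NaN. *)
definition rcp_solution ::
  "('x::real_inner) set \<Rightarrow> 'x \<Rightarrow> ('x \<Rightarrow> 'p \<Rightarrow> real) \<Rightarrow> (nat \<Rightarrow> 'p) \<Rightarrow> nat set \<Rightarrow> 'x option" where
  "rcp_solution X a f \<delta> S =
     (if rcp_feasible X f \<delta> S = {} then None else Some (THE x. rcp_optimal X a f \<delta> S x))"

(* The infimum over the empty set is \<infinity>, the value of an infeasible problem. *)
definition rcp_value ::
  "('x::real_inner) set \<Rightarrow> 'x \<Rightarrow> ('x \<Rightarrow> 'p \<Rightarrow> real) \<Rightarrow> (nat \<Rightarrow> 'p) \<Rightarrow> nat set \<Rightarrow> ereal" where
  "rcp_value X a f \<delta> S = (INF x\<in>rcp_feasible X f \<delta> S. ereal (a \<bullet> x))"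

definition support_constraints ::
  "('x::real_inner) set \<Rightarrow> 'x \<Rightarrow> ('x \<Rightarrow> 'p \<Rightarrow> real) \<Rightarrow> (nat \<Rightarrow> 'p) \<Rightarrow> nat set \<Rightarrow> nat set" where
  "support_constraints X a f \<delta> C = {c \<in> C. rcp_value X a f \<delta> (C - {c}) < rcp_value X a f \<delta> C}"

(* A set of indices: if several samples coincide with an extreme point, all their indices belong. *)
definition vert :: "(nat \<Rightarrow> 'p::real_vector) \<Rightarrow> nat set \<Rightarrow> nat set" where
  "vert \<delta> S = {j \<in> S. \<delta> j extreme_point_of (convex hull (\<delta> ` S))}"

definition digraph_dist :: "('v, 'e) pre_digraph \<Rightarrow> 'v \<Rightarrow> 'v \<Rightarrow> nat" where
  "digraph_dist G u v = (LEAST k. \<exists>p. pre_digraph.apath G u p v \<and> length p = k)"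

(* Meaningful for finite, nonempty, strongly connected digraphs. *)
definition digraph_diam :: "('v, 'e) pre_digraph \<Rightarrow> nat" where
  "digraph_diam G = Max {digraph_dist G u v | u v. u \<in> verts G \<and> v \<in> verts G}"

definition in_neighbors :: "('v, 'e) pre_digraph \<Rightarrow> 'v \<Rightarrow> 'v set" where
  "in_neighbors G i = {j. j \<rightarrow>\<^bsub>G\<^esub> i}"

(* vcc G \<delta> Cl t i is the candidate set of node i after t rounds; Cl i is its initial set.  The
   recursion is defined for all t, the algorithm runs for t up to the diameter of G. *)
primrec vcc ::
  "('v, 'e) pre_digraph \<Rightarrow> (nat \<Rightarrow> 'p::real_vector) \<Rightarrow> ('v \<Rightarrow> nat set) \<Rightarrow> nat \<Rightarrow> 'v \<Rightarrow> nat set" where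
  "vcc G \<delta> Cl 0 = (\<lambda>i. vert \<delta> (Cl i))"
| "vcc G \<delta> Cl (Suc t) =
     (\<lambda>i. vert \<delta> (vcc G \<delta> Cl t i \<union> (\<Union>j\<in>in_neighbors G i. vcc G \<delta> Cl t j)))"

end

theory Submission
  imports Defs
begin

text \<open>
  Two facts about convexity carry the argument.  A finite point set and its extreme points have the
  same convex hull (Minkowski's theorem), and a function that is convex in the parameter and
  nonpositive on a set of samples is nonpositive on their convex hull.  So replacing an index set by
  its vertex set leaves the feasible region unchanged (\<open>rcp_feasible_vert\<close>), and with it the
  solution and the value.

  On the side of the algorithm, pruning to the vertex set loses nothing, because pruning commutes
  with merging: the vertex set of a union of index sets is determined by their vertex sets
  (\<open>vert_Union_vert\<close>).  So every candidate set of the algorithm is the vertex set of the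
  index set that the node would hold if the nodes flooded the network with their full sets and
  pruned nothing (\<open>vcc_eq_vert_flood\<close>).

  The flooded sets only grow, so the feasible regions shrink and the values do not decrease.
  A walk of length \<open>k\<close> carries the initial set of its first node to its last node in
  \<open>k\<close> rounds, so after as many rounds as the diameter every node holds all indices and its
  candidate set is the vertex set of the whole problem.  An index outside that vertex set is no
  support constraint: the problem without it still contains all vertices and therefore has the same
  feasible region as the full one.
\<close>

section \<open>Vertex sets\<close>

lemma vert_subset: "vert \<delta> S \<subseteq> S"
  by (auto simp: vert_def)

lemma convex_hull_vert:
  fixes \<delta> :: "nat \<Rightarrow> 'p::euclidean_space"
  assumes "finite S"
  shows "convex hull (\<delta> ` vert \<delta> S) = convex hull (\<delta> ` S)"
proof -
  let ?H = "convex hull (\<delta> ` S)"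
  have "{q. q extreme_point_of ?H} = \<delta> ` vert \<delta> S"
    by (auto simp: vert_def dest: extreme_point_of_convex_hull)
  moreover have "compact ?H"
    using assms by (simp add: finite_imp_compact_convex_hull)
  ultimately show ?thesis
    using Krein_Milman_Minkowski[of ?H] by simp
qed

text \<open>A set between an index set and its vertex set spans the same hull, and extremality of a point
  depends on the hull only.\<close>

lemma vert_sandwich:
  fixes \<delta> :: "nat \<Rightarrow> 'p::euclidean_space"
  assumes "finite U" "vert \<delta> U \<subseteq> W" "W \<subseteq> U"
  shows "vert \<delta> W = vert \<delta> U"
proof -
  have "convex hull (\<delta> ` W) = convex hull (\<delta> ` U)"
  proof
    show "convex hull (\<delta> ` W) \<subseteq> convex hull (\<delta> ` U)"
      using assms by (intro hull_mono image_mono)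
    have "convex hull (\<delta> ` vert \<delta> U) \<subseteq> convex hull (\<delta> ` W)"
      using assms by (intro hull_mono image_mono)
    then show "convex hull (\<delta> ` U) \<subseteq> convex hull (\<delta> ` W)"
      using assms by (simp add: convex_hull_vert)
  qed
  then show ?thesis
    using assms by (auto simp: vert_def)
qed

text \<open>A point that is extreme in a larger hull stays extreme in every smaller hull containing it,
  so a vertex of the union is a vertex of each member it comes from.\<close>

lemma vert_Union_subset: "vert \<delta> (\<Union>(S ` I)) \<subseteq> (\<Union>i\<in>I. vert \<delta> (S i))"
proof
  fix j assume "j \<in> vert \<delta> (\<Union>(S ` I))"
  then obtain i where i: "i \<in> I" "j \<in> S i"
    and ext: "\<delta> j extreme_point_of (convex hull (\<delta> ` \<Union>(S ` I)))"
    by (auto simp: vert_def)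
  have "convex hull (\<delta> ` S i) \<subseteq> convex hull (\<delta> ` \<Union>(S ` I))"
    using i by (intro hull_mono) auto
  moreover have "\<delta> j \<in> convex hull (\<delta> ` S i)"
    using i by (simp add: hull_inc)
  ultimately have "\<delta> j extreme_point_of (convex hull (\<delta> ` S i))"
    using ext by (auto simp: extreme_point_of_def)
  then show "j \<in> (\<Union>i\<in>I. vert \<delta> (S i))"
    using i by (auto simp: vert_def)
qed

lemma vert_Union_vert:
  fixes \<delta> :: "nat \<Rightarrow> 'p::euclidean_space"
  assumes "finite (\<Union>(S ` I))"
  shows "vert \<delta> (\<Union>i\<in>I. vert \<delta> (S i)) = vert \<delta> (\<Union>(S ` I))"
proof (rule vert_sandwich[OF assms vert_Union_subset])
  show "(\<Union>i\<in>I. vert \<delta> (S i)) \<subseteq> \<Union>(S ` I)"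
    by (intro UN_mono order_refl vert_subset)
qed

section \<open>Feasible regions and vertex sets\<close>

lemma rcp_feasible_antimono:
  "S \<subseteq> U \<Longrightarrow> rcp_feasible X f \<delta> U \<subseteq> rcp_feasible X f \<delta> S"
  by (auto simp: rcp_feasible_def)

text \<open>The samples of the discarded indices lie in the hull of the vertices, where convexity in the
  parameter bounds the constraint by its values at the vertices.\<close>

lemma rcp_feasible_vert:
  fixes \<delta> :: "nat \<Rightarrow> 'p::euclidean_space"
  assumes "finite S" "convex \<Delta>" "\<delta> ` S \<subseteq> \<Delta>"
    and "\<And>x. x \<in> X \<Longrightarrow> convex_on \<Delta> (f x)"
  shows "rcp_feasible X f \<delta> (vert \<delta> S) = rcp_feasible X f \<delta> S"
proof
  show "rcp_feasible X f \<delta> S \<subseteq> rcp_feasible X f \<delta> (vert \<delta> S)"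
    by (intro rcp_feasible_antimono vert_subset)
  show "rcp_feasible X f \<delta> (vert \<delta> S) \<subseteq> rcp_feasible X f \<delta> S"
  proof
    fix x assume x: "x \<in> rcp_feasible X f \<delta> (vert \<delta> S)"
    let ?H = "convex hull (\<delta> ` vert \<delta> S)"
    have "\<delta> ` vert \<delta> S \<subseteq> \<Delta>"
      using assms(3) vert_subset by blast
    then have "?H \<subseteq> \<Delta>"
      using assms(2) by (simp add: hull_minimal)
    moreover have "convex_on \<Delta> (f x)"
      using x assms(4) by (simp add: rcp_feasible_def)
    ultimately have "convex_on ?H (f x)"
      using convex_on_subset convex_convex_hull by blast
    then have "\<forall>q\<in>?H. f x q \<le> 0"
      by (rule convex_on_convex_hull_bound) (use x in \<open>auto simp: rcp_feasible_def\<close>)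
    moreover have "\<delta> ` S \<subseteq> ?H"
      using assms(1) by (simp add: convex_hull_vert hull_subset)
    ultimately show "x \<in> rcp_feasible X f \<delta> S"
      using x by (auto simp: rcp_feasible_def)
  qed
qed

text \<open>Solution and value see an index set only through its feasible region.\<close>

lemma rcp_solution_cong:
  "rcp_feasible X f \<delta> S = rcp_feasible X f \<delta> U \<Longrightarrow>
    rcp_solution X a f \<delta> S = rcp_solution X a f \<delta> U"
  by (simp add: rcp_solution_def rcp_optimal_def[abs_def])

lemma rcp_value_mono:
  "rcp_feasible X f \<delta> U \<subseteq> rcp_feasible X f \<delta> S \<Longrightarrow>
    rcp_value X a f \<delta> S \<le> rcp_value X a f \<delta> U"
  unfolding rcp_value_def by (rule INF_superset_mono) simp_all

lemma support_constraints_subset_vert: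
  fixes \<delta> :: "nat \<Rightarrow> 'p::euclidean_space"
  assumes "finite C" "convex \<Delta>" "\<delta> ` C \<subseteq> \<Delta>"
    and "\<And>x. x \<in> X \<Longrightarrow> convex_on \<Delta> (f x)"
  shows "support_constraints X a f \<delta> C \<subseteq> vert \<delta> C"
proof
  fix c assume c: "c \<in> support_constraints X a f \<delta> C"
  show "c \<in> vert \<delta> C"
  proof (rule ccontr)
    assume "c \<notin> vert \<delta> C"
    then have "vert \<delta> C \<subseteq> C - {c}"
      using vert_subset by blast
    then have "rcp_feasible X f \<delta> (C - {c}) \<subseteq> rcp_feasible X f \<delta> (vert \<delta> C)"
      by (rule rcp_feasible_antimono)
    also have "\<dots> = rcp_feasible X f \<delta> C"
      using assms by (rule rcp_feasible_vert)
    finally have "rcp_feasible X f \<delta> (C - {c}) \<subseteq> rcp_feasible X f \<delta> C" .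
    then have "rcp_value X a f \<delta> C \<le> rcp_value X a f \<delta> (C - {c})"
      by (rule rcp_value_mono)
    moreover have "rcp_value X a f \<delta> (C - {c}) < rcp_value X a f \<delta> C"
      using c by (simp add: support_constraints_def)
    ultimately show False
      by (rule leD[THEN notE])
  qed
qed

section \<open>Flooding the network\<close>

text \<open>The consensus algorithm without pruning, as a yardstick for what pruning preserves.\<close>

primrec flood :: "('v, 'e) pre_digraph \<Rightarrow> ('v \<Rightarrow> 'c set) \<Rightarrow> nat \<Rightarrow> 'v \<Rightarrow> 'c set" where
  "flood G K 0 = K"
| "flood G K (Suc t) = (\<lambda>i. flood G K t i \<union> (\<Union>j\<in>in_neighbors G i. flood G K t j))"

lemma flood_mono: "s \<le> t \<Longrightarrow> flood G K s i \<subseteq> flood G K t i"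
  by (rule lift_Suc_mono_le[of "\<lambda>t. flood G K t i"]) auto

text \<open>Each arc of the walk takes one round, starting from an arbitrary round \<open>s\<close> so that the
  induction can peel off the first arc.\<close>

lemma flood_along_walk:
  assumes "pre_digraph.cas G u p v" "set p \<subseteq> arcs G"
  shows "flood G K s u \<subseteq> flood G K (s + length p) v"
  using assms
proof (induction p arbitrary: u s)
  case Nil
  then show ?case by (simp add: pre_digraph.cas.simps)
next
  case (Cons e p)
  then have "tail G e = u" "e \<in> arcs G" and walk: "pre_digraph.cas G (head G e) p v"
    by (simp_all add: pre_digraph.cas.simps)
  then have "u \<in> in_neighbors G (head G e)"
    by (force simp: in_neighbors_def arcs_ends_def arc_to_ends_def)
  then have "flood G K s u \<subseteq> flood G K (Suc s) (head G e)"
    by auto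
  also have "\<dots> \<subseteq> flood G K (Suc s + length p) v"
    using walk Cons.prems(2) by (intro Cons.IH) simp_all
  finally show ?case by simp
qed

context wf_digraph
begin

text \<open>Well-formedness keeps in-neighbours inside the graph, so whatever reaches a node started at a
  node of the graph.\<close>

lemma flood_subset:
  assumes "\<And>i. i \<in> verts G \<Longrightarrow> K i \<subseteq> C" "i \<in> verts G"
  shows "flood G K t i \<subseteq> C"
  using assms(2)
proof (induction t arbitrary: i)
  case 0
  then show ?case using assms(1) by simp
next
  case (Suc t)
  moreover have "in_neighbors G i \<subseteq> verts G"
    by (auto simp: in_neighbors_def adj_in_verts)
  ultimately show ?case by fastforce
qed

text \<open>Each round merges and then prunes; pruning the merged sets once more cannot tell whether the
  parts were pruned before.\<close>

lemma vcc_eq_vert_flood: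
  fixes \<delta> :: "nat \<Rightarrow> 'p::euclidean_space"
  assumes fin: "\<And>i. i \<in> verts G \<Longrightarrow> K i \<subseteq> C" "finite C" and "i \<in> verts G"
  shows "vcc G \<delta> K t i = vert \<delta> (flood G K t i)"
  using assms(3)
proof (induction t arbitrary: i)
  case 0
  then show ?case by simp
next
  case (Suc t)
  let ?I = "insert i (in_neighbors G i)"
  have I: "?I \<subseteq> verts G"
    using Suc.prems by (auto simp: in_neighbors_def adj_in_verts)
  have "(\<Union>j\<in>?I. flood G K t j) \<subseteq> C"
    using I by (intro UN_least flood_subset fin(1)) auto
  then have finite: "finite (\<Union>j\<in>?I. flood G K t j)"
    using fin(2) by (rule finite_subset)
  have "vcc G \<delta> K (Suc t) i = vert \<delta> (\<Union>j\<in>?I. vcc G \<delta> K t j)"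
    by simp
  also have "(\<Union>j\<in>?I. vcc G \<delta> K t j) = (\<Union>j\<in>?I. vert \<delta> (flood G K t j))"
    using Suc.IH I by (intro SUP_cong) auto
  also have "vert \<delta> \<dots> = vert \<delta> (\<Union>j\<in>?I. flood G K t j)"
    using finite by (rule vert_Union_vert)
  finally show ?case by simp
qed

end

lemma (in fin_digraph) walk_within_diameter:
  assumes "strongly_connected G" "u \<in> verts G" "v \<in> verts G"
  obtains p where "awalk u p v" "length p \<le> digraph_diam G"
proof -
  have "\<exists>k p. apath u p v \<and> length p = k"
    using assms reachable_apath by (auto simp: strongly_connected_def)
  then have "\<exists>p. apath u p v \<and> length p = digraph_dist G u v"
    unfolding digraph_dist_def by (rule LeastI_ex)
  then obtain p where p: "apath u p v" "length p = digraph_dist G u v"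
    by blast
  have "{digraph_dist G u v | u v. u \<in> verts G \<and> v \<in> verts G} =
      (\<lambda>(u, v). digraph_dist G u v) ` (verts G \<times> verts G)"
    by auto
  then have "finite {digraph_dist G u v | u v. u \<in> verts G \<and> v \<in> verts G}"
    by simp
  then have "digraph_dist G u v \<le> digraph_diam G"
    unfolding digraph_diam_def using assms by (intro Max_ge) auto
  with p show thesis
    by (intro that[of p]) (auto simp: apath_def)
qed

lemma (in fin_digraph) flood_diameter:
  assumes "strongly_connected G" "v \<in> verts G"
  shows "flood G K (digraph_diam G) v = (\<Union>u\<in>verts G. K u)"
proof
  show "flood G K (digraph_diam G) v \<subseteq> (\<Union>u\<in>verts G. K u)"
    by (rule flood_subset) (use assms in auto)
  show "(\<Union>u\<in>verts G. K u) \<subseteq> flood G K (digraph_diam G) v"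
  proof (rule UN_least)
    fix u assume "u \<in> verts G"
    then obtain p where p: "awalk u p v" "length p \<le> digraph_diam G"
      using assms walk_within_diameter by blast
    have "K u \<subseteq> flood G K (length p) v"
      using flood_along_walk[of G u p v K 0] p by (simp add: awalk_def)
    also have "\<dots> \<subseteq> flood G K (digraph_diam G) v"
      using p by (intro flood_mono)
    finally show "K u \<subseteq> flood G K (digraph_diam G) v" .
  qed
qed

section \<open>Correctness of vertex constraints consensus\<close>

theorem proposition4:
  fixes X :: "(real ^ 'd) set" and a :: "real ^ 'd"
    and \<Delta> :: "(real ^ 'l) set"
    and f :: "real ^ 'd \<Rightarrow> real ^ 'l \<Rightarrow> real"
    and N :: nat and \<delta> :: "nat \<Rightarrow> real ^ 'l"
    and n :: nat and G :: "nat pair_pre_digraph" and Cl :: "nat \<Rightarrow> nat set"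
  assumes "compact X" and "convex X" and "convex \<Delta>"
    and "\<And>q. q \<in> \<Delta> \<Longrightarrow> convex_on UNIV (\<lambda>x. f x q)"
    and "\<And>j. j \<in> {1..N} \<Longrightarrow> \<delta> j \<in> \<Delta>"
    and unique_minimum:
      "\<And>S. S \<subseteq> {1..N} \<Longrightarrow> rcp_feasible X f \<delta> S \<noteq> {} \<Longrightarrow> \<exists>!x. rcp_optimal X a f \<delta> S x"
    and "pair_fin_digraph G" and "pverts G = {1..n}" and "strongly_connected G"
    and "\<And>i. i \<in> {1..n} \<Longrightarrow> Cl i \<subseteq> {1..N}" and "(\<Union>i\<in>{1..n}. Cl i) = {1..N}"
    and "\<And>x. x \<in> X \<Longrightarrow> convex_on \<Delta> (\<lambda>q. f x q)"
  shows
    "(\<forall>i\<in>{1..n}. mono_on {..digraph_diam G} (\<lambda>t. rcp_value X a f \<delta> (vcc G \<delta> Cl t i)))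
     \<and> (\<exists>T\<le>digraph_diam G. \<forall>t\<in>{T..digraph_diam G}. \<forall>i\<in>{1..n}.
          rcp_solution X a f \<delta> (vcc G \<delta> Cl t i) = rcp_solution X a f \<delta> {1..N}
          \<and> vcc G \<delta> Cl t i = vert \<delta> {1..N}
          \<and> support_constraints X a f \<delta> {1..N} \<subseteq> vert \<delta> {1..N})"
proof -
  let ?D = "digraph_diam G"
  let ?V = "vcc G \<delta> Cl"
  interpret pair_fin_digraph G by fact
  have fin_digraph: "fin_digraph (with_proj G)" by (rule fin_digraph_axioms)
  have wf: "wf_digraph (with_proj G)" by (rule wf_digraph_axioms)
  have verts: "verts (with_proj G) = {1..n}"
    using \<open>pverts G = {1..n}\<close> by simp
  have Cl: "\<And>i. i \<in> verts (with_proj G) \<Longrightarrow> Cl i \<subseteq> {1..N}"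
    using assms(10) verts by simp
  have flood: "flood G Cl t i \<subseteq> {1..N}" if "i \<in> {1..n}" for t i
    using that verts by (intro wf_digraph.flood_subset[OF wf] Cl) simp_all
  have vcc: "?V t i = vert \<delta> (flood G Cl t i)" if "i \<in> {1..n}" for t i
    using that verts by (intro wf_digraph.vcc_eq_vert_flood[OF wf, where C = "{1..N}"] Cl) simp_all
  have samples: "\<delta> ` S \<subseteq> \<Delta>" if "S \<subseteq> {1..N}" for S
    using assms(5) that by blast
  have feasible_vert: "rcp_feasible X f \<delta> (vert \<delta> S) = rcp_feasible X f \<delta> S"
    if "S \<subseteq> {1..N}" for S
    using that finite_subset \<open>convex \<Delta>\<close> samples assms(12)
    by (intro rcp_feasible_vert[where \<Delta> = \<Delta>]) auto
  have "mono_on {..?D} (\<lambda>t. rcp_value X a f \<delta> (?V t i))" if i: "i \<in> {1..n}" for i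
  proof (rule mono_onI)
    fix s t :: nat assume "s \<le> t"
    then have "rcp_feasible X f \<delta> (flood G Cl t i) \<subseteq> rcp_feasible X f \<delta> (flood G Cl s i)"
      by (intro rcp_feasible_antimono flood_mono)
    then show "rcp_value X a f \<delta> (?V s i) \<le> rcp_value X a f \<delta> (?V t i)"
      by (intro rcp_value_mono) (simp only: vcc[OF i] feasible_vert[OF flood[OF i]])
  qed
  moreover have "?V ?D i = vert \<delta> {1..N}" if i: "i \<in> {1..n}" for i
  proof -
    have "flood G Cl ?D i = (\<Union>u\<in>verts (with_proj G). Cl u)"
      using i verts \<open>strongly_connected G\<close>
      by (intro fin_digraph.flood_diameter[OF fin_digraph]) auto
    then show ?thesis
      using vcc[OF i] verts assms(11) by simp
  qed
  moreover have "rcp_solution X a f \<delta> (vert \<delta> {1..N}) = rcp_solution X a f \<delta> {1..N}"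
    by (intro rcp_solution_cong feasible_vert) simp
  moreover have "support_constraints X a f \<delta> {1..N} \<subseteq> vert \<delta> {1..N}"
    using \<open>convex \<Delta>\<close> samples assms(12)
    by (intro support_constraints_subset_vert[where \<Delta> = \<Delta>]) auto
  ultimately show ?thesis
    by (intro conjI exI[of _ ?D]) auto
qed

end
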